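(* Let $E\subset\mathbb{R}$ be a bounded interval and $\phi(y)=y-1/y$. Then $$S=\{(x,y)\in\mathbb{R}^2:\ x-\phi(y)\in E\}$$ is an open set which contains no straight line; moreover, $S$ does not coincide up to a null set with any diagonal set.
   Context: The function $\phi(y)=y-1/y$ is defined for real $y\neq0$. A measurable set $D\subset\mathbb{R}^2$ is called a diagonal set if it is a union of parallel lines of positive slope, that is, $D=\{(x,y):\ \alpha y-\beta x\in E'\}$ for some $\alpha,\beta>0$ and some measurable $E'\subset\mathbb{R}$.
   Formalization: The bounded interval E is assumed to have nonempty interior, and S is claimed to be open only when E is open; for E = [0,1] the set S is not open, and for E a single point S is null and so agrees a.e. with the empty diagonal set. *)

theory Defs
  imports "HOL-Analysis.Analysis"
begin

definition phi :: "real \<Rightarrow> real" where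
  "phi y = y - 1 / y"

(* phi is only meaningful for y \<noteq> 0, but it is a total function here (phi 0 = 0),
   so the axis y = 0 has to be excluded explicitly. *)
definition phi_strip :: "real set \<Rightarrow> (real \<times> real) set" where
  "phi_strip E = {(x, y). y \<noteq> 0 \<and> x - phi y \<in> E}"

definition straight_line :: "(real \<times> real) set \<Rightarrow> bool" where
  "straight_line L \<longleftrightarrow> (\<exists>p v. v \<noteq> 0 \<and> L = {p + t *\<^sub>R v |t. True})"

(* "Measurable" means Lebesgue measurable. *)
definition diagonal_set :: "(real \<times> real) set \<Rightarrow> bool" where
  "diagonal_set D \<longleftrightarrow> D \<in> sets lebesgue \<and>
     (\<exists>\<alpha> \<beta> E'. \<alpha> > 0 \<and> \<beta> > 0 \<and> E' \<in> sets lebesgue \<and>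
        D = {(x, y). \<alpha> * y - \<beta> * x \<in> E'})"

definition coincide_up_to_null :: "(real \<times> real) set \<Rightarrow> (real \<times> real) set \<Rightarrow> bool" where
  "coincide_up_to_null A B \<longleftrightarrow> (A - B) \<union> (B - A) \<in> null_sets lebesgue"

end

theory Submission
  imports Defs
begin

text \<open>
  A non-horizontal line meets the axis \<open>y = 0\<close>, and along a horizontal line \<open>x - \<phi>(y)\<close> is
  unbounded. A diagonal set is invariant under translation along its direction. Since \<open>\<phi>\<close> has a
  pole at \<open>0\<close>, moving an interior point of the strip in a non-horizontal direction close to the
  axis \<open>y = 0\<close> takes it off the strip; hence so for a whole neighbourhood, which would have to be
  a null set if the strip agreed almost everywhere with a diagonal set.
\<close>

lemma open_phi_strip:
  assumes "open E"
  shows "open (phi_strip E)"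
proof -
  let ?A = "UNIV \<times> (- {0}) :: (real \<times> real) set"
  have "continuous_on ?A (\<lambda>p. fst p - phi (snd p))"
    unfolding phi_def by (intro continuous_intros) auto
  moreover have "open ?A"
    by (intro open_Times) auto
  ultimately have "open ((\<lambda>p. fst p - phi (snd p)) -` E \<inter> ?A)"
    using assms continuous_on_open_vimage by blast
  moreover have "phi_strip E = (\<lambda>p. fst p - phi (snd p)) -` E \<inter> ?A"
    by (auto simp: phi_strip_def)
  ultimately show ?thesis
    by simp
qed

lemma phi_strip_contains_no_line:
  assumes "bounded E" and "straight_line L"
  shows "\<not> L \<subseteq> phi_strip E"
proof
  assume sub: "L \<subseteq> phi_strip E"
  obtain p w where "w \<noteq> 0" and L: "L = {p + t *\<^sub>R w |t. True}"
    using assms(2) unfolding straight_line_def by blast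
  obtain a b u v where p: "p = (a, b)" and w: "w = (u, v)"
    by (metis surj_pair)
  have uv: "u \<noteq> 0 \<or> v \<noteq> 0"
    using \<open>w \<noteq> 0\<close> w by (auto simp: zero_prod_def)
  have mem: "(a + t * u, b + t * v) \<in> phi_strip E" for t
  proof -
    have "p + t *\<^sub>R w \<in> L" unfolding L by blast
    then show ?thesis using sub p w by auto
  qed
  show False
  proof (cases "v = 0")
    case True
    obtain M where M: "\<And>z. z \<in> E \<Longrightarrow> \<bar>z\<bar> \<le> M"
      using assms(1) by (auto simp: bounded_iff)
    have "u \<noteq> 0" using uv True by simp
    then have "M + 1 \<in> E"
      \<comment> \<open>The parameter at which the horizontal line reaches
        \<open>x - phi b = M + 1\<close>, a value beyond the bound for \<open>E\<close>.\<close>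
      using mem[of "(M + 1 + phi b - a) / u"] True by (simp add: phi_strip_def)
    then show False
      using M by fastforce
  next
    case False
    then show False
      \<comment> \<open>The parameter at which the line crosses \<open>y = 0\<close>.\<close>
      using mem[of "- b / v"] by (simp add: phi_strip_def)
  qed
qed

text \<open>The form \<alpha> * y - \<beta> * x vanishes on the direction (\<alpha> / \<beta>, 1),
  so \<open>r\<close> is the inverse slope and \<open>d\<close> the vertical displacement.\<close>

lemma diagonal_set_translation:
  assumes "diagonal_set D"
  obtains r where "\<And>p d. p + (d * r, d) \<in> D \<longleftrightarrow> p \<in> D"
proof -
  obtain \<alpha> \<beta> E' where "\<beta> > 0" and D: "D = {(x, y). \<alpha> * y - \<beta> * x \<in> E'}"
    using assms unfolding diagonal_set_def by blast
  have "\<alpha> * (y + d) - \<beta> * (x + d * (\<alpha> / \<beta>)) = \<alpha> * y - \<beta> * x" for x y d :: real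
    using \<open>\<beta> > 0\<close> by (simp add: field_simps)
  then have "p + (d * (\<alpha> / \<beta>), d) \<in> D \<longleftrightarrow> p \<in> D" for p d
    unfolding D by (cases p) simp
  then show thesis by (rule that)
qed

text \<open>A point \<open>p\<close> of \<open>W\<close> outside \<open>D\<close> lies in
  \<open>S - D\<close>; if it is in \<open>D\<close>, then \<open>p + w\<close> lies in
  \<open>D - S\<close>. So \<open>W\<close> is covered by a null set and a translate of it, whereas
  a nonempty open set is not null.\<close>

lemma open_translate_off_imp_empty:
  fixes S D W :: "(real \<times> real) set"
  assumes "coincide_up_to_null S D" and inv: "\<And>p. p + w \<in> D \<longleftrightarrow> p \<in> D"
    and "open W" and "W \<subseteq> S" and off: "\<And>p. p \<in> W \<Longrightarrow> p + w \<notin> S"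
  shows "W = {}"
proof -
  let ?N = "(S - D) \<union> (D - S)"
  have N: "negligible ?N"
    using assms(1) by (simp add: coincide_up_to_null_def negligible_iff_null_sets)
  have "W \<subseteq> ?N \<union> (+) (- w) ` ?N"
  proof
    fix p assume "p \<in> W"
    show "p \<in> ?N \<union> (+) (- w) ` ?N"
    proof (cases "p \<in> D")
      case True
      then have "p + w \<in> ?N" using off[OF \<open>p \<in> W\<close>] inv by simp
      then have "- w + (p + w) \<in> (+) (- w) ` ?N" by (rule imageI)
      then show ?thesis by simp
    next
      case False
      then show ?thesis using \<open>p \<in> W\<close> \<open>W \<subseteq> S\<close> by blast
    qed
  qed
  moreover have "negligible (?N \<union> (+) (- w) ` ?N)"
    by (rule negligible_Un[OF N negligible_translation[OF N]])
  ultimately have "negligible W"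
    by (rule negligible_subset[rotated])
  then show ?thesis
    using open_not_negligible[OF \<open>open W\<close>] by blast
qed

text \<open>As \<open>s\<close> tends to 0 from above, \<open>- phi s = 1 / s - s\<close> tends to
  infinity while \<open>(s - 1) * r\<close> stays bounded. The expression is the value of
  \<open>x - phi y\<close> at the point of height \<open>s\<close> on the line through
  \<open>(e, 1)\<close> with direction \<open>(r, 1)\<close>.\<close>

lemma phi_pole:
  obtains s where "s > 0" and "e + (s - 1) * r - phi s > M"
proof -
  \<comment> \<open>The summand 2 absorbs \<open>- s\<close>, which is at least -1, and leaves 1 for
    strictness.\<close>
  define s where "s = 1 / (\<bar>M\<bar> + \<bar>e\<bar> + \<bar>r\<bar> + 2)"
  have s: "0 < s" "s \<le> 1" "1 / s = \<bar>M\<bar> + \<bar>e\<bar> + \<bar>r\<bar> + 2"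
    unfolding s_def by simp_all
  have "\<bar>(s - 1) * r\<bar> \<le> 1 * \<bar>r\<bar>"
    unfolding abs_mult using s by (intro mult_right_mono) auto
  then have "e + (s - 1) * r - phi s > M"
    using s unfolding phi_def by linarith
  with s show thesis using that by blast
qed

lemma phi_strip_not_diagonal:
  assumes "bounded E" and "interior E \<noteq> {}" and "diagonal_set D"
  shows "\<not> coincide_up_to_null (phi_strip E) D"
proof
  assume coin: "coincide_up_to_null (phi_strip E) D"
  obtain M where M: "\<And>z. z \<in> E \<Longrightarrow> \<bar>z\<bar> \<le> M"
    using assms(1) by (auto simp: bounded_iff)
  obtain e where e: "e \<in> interior E"
    using assms(2) by blast
  obtain r where r: "\<And>p d. p + (d * r, d) \<in> D \<longleftrightarrow> p \<in> D"
    using diagonal_set_translation[OF assms(3)] by blast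
  obtain s where s: "s > 0" "e + (s - 1) * r - phi s > M"
    using phi_pole by blast
  \<comment> \<open>Since \<open>phi 1 = 0\<close>, the point \<open>(e, 1)\<close> has value
    \<open>e\<close>; \<open>w\<close> moves it along \<open>D\<close> to height \<open>s\<close>,
    where the value exceeds \<open>M\<close>. \<open>W\<close> collects the points that behave
    alike.\<close>
  define w where "w = ((s - 1) * r, s - 1)"
  define W where "W = phi_strip (interior E) \<inter> (\<lambda>p. p + w) -` phi_strip {M<..}"
  have "open W"
    unfolding W_def
    by (intro open_Int open_vimage open_phi_strip continuous_intros) auto
  moreover have "W \<subseteq> phi_strip E"
    using interior_subset[of E] by (auto simp: W_def phi_strip_def)
  moreover have "p + w \<notin> phi_strip E" if "p \<in> W" for p
    using that M by (cases p) (force simp: W_def phi_strip_def w_def)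
  ultimately have "W = {}"
    using open_translate_off_imp_empty[OF coin, of w W] r unfolding w_def by blast
  moreover have "(e, 1) \<in> W"
    using e s by (simp add: W_def w_def phi_strip_def phi_def)
  ultimately show False
    by blast
qed

text \<open>Openness is claimed for open \<open>E\<close> only, as an interval may contain
  endpoints. For empty or one-point \<open>E\<close> the strip is null and agrees with the empty
  diagonal set, hence the nonempty interior.\<close>

theorem proposition1:
  fixes E :: "real set"
  assumes "is_interval E" and "bounded E" and "interior E \<noteq> {}"
  shows "(open E \<longrightarrow> open (phi_strip E)) \<and>
         \<not> (\<exists>L. straight_line L \<and> L \<subseteq> phi_strip E) \<and>
         \<not> (\<exists>D. diagonal_set D \<and> coincide_up_to_null (phi_strip E) D)"
  using open_phi_strip phi_strip_contains_no_line[OF assms(2)]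
    phi_strip_not_diagonal[OF assms(2,3)] by (intro conjI) auto

end
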